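(* A change of basis groupoid is a small category $\mathrm{CB}$: its set of objects $\mathrm{obj}\,\mathrm{CB}$ is a finite set of polynomial bases, each spanning the same vector space, and its morphisms are change of basis matrices, such that for every $v,t\in\mathrm{obj}\,\mathrm{CB}$ there is a unique $M_{vt}\in\mathrm{hom}\,\mathrm{CB}$ with $M_{vt}:v\to t$.
   Context: For ordered bases $v,t$ of the same finite-dimensional real vector space of polynomials, $M_{vt}$ is the matrix whose $j$-th column is the coordinate vector with respect to $v$ of the $j$-th element of $t$. A change of basis groupoid consists of all change of basis matrices $M_{vt}$ for $v,t$ in a finite set of bases of the same space, one for each ordered pair $(v,t)$, with matrix inversion and the matrix products $M_{vr}M_{rt}=M_{vt}$ as operations. Composition in $\mathrm{CB}$ of $M_{vr}:v\to r$ and $M_{rt}:r\to t$ is $M_{vr}\circ M_{rt}=M_{vr}M_{rt}$, and the identity morphism of $v$ is $M_{vv}$. *)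

theory Defs
  imports
    "HOL-Computational_Algebra.Polynomial"
    "Jordan_Normal_Form.Matrix"
    "Jordan_Normal_Form.Gauss_Jordan_Elimination"
begin

interpretation poly_vs: vector_space "Polynomial.smult :: real \<Rightarrow> real poly \<Rightarrow> real poly"
  by unfold_locales (simp_all add: Polynomial.smult_add_right Polynomial.smult_add_left)

(* Composition is written in diagrammatic order: f : x -> y and g : y -> z give Comp C f g : x -> z.
   Smallness is automatic, since Obj and Hom are sets. Comp is constrained on composable pairs only. *)

record ('o, 'a) category =
  Obj :: "'o set"
  Hom :: "'a set"
  Dom :: "'a \<Rightarrow> 'o"
  Cod :: "'a \<Rightarrow> 'o"
  Id :: "'o \<Rightarrow> 'a"
  Comp :: "'a \<Rightarrow> 'a \<Rightarrow> 'a"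

locale small_category =
  fixes C :: "('o, 'a, 'z) category_scheme"
  assumes Dom_in_Obj: "f \<in> Hom C \<Longrightarrow> Dom C f \<in> Obj C"
    and Cod_in_Obj: "f \<in> Hom C \<Longrightarrow> Cod C f \<in> Obj C"
    and Id_in_Hom: "x \<in> Obj C \<Longrightarrow> Id C x \<in> Hom C"
    and Dom_Id: "x \<in> Obj C \<Longrightarrow> Dom C (Id C x) = x"
    and Cod_Id: "x \<in> Obj C \<Longrightarrow> Cod C (Id C x) = x"
    and Comp_in_Hom: "\<lbrakk>f \<in> Hom C; g \<in> Hom C; Cod C f = Dom C g\<rbrakk> \<Longrightarrow> Comp C f g \<in> Hom C"
    and Dom_Comp: "\<lbrakk>f \<in> Hom C; g \<in> Hom C; Cod C f = Dom C g\<rbrakk> \<Longrightarrow> Dom C (Comp C f g) = Dom C f"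
    and Cod_Comp: "\<lbrakk>f \<in> Hom C; g \<in> Hom C; Cod C f = Dom C g\<rbrakk> \<Longrightarrow> Cod C (Comp C f g) = Cod C g"
    and Id_left: "f \<in> Hom C \<Longrightarrow> Comp C (Id C (Dom C f)) f = f"
    and Id_right: "f \<in> Hom C \<Longrightarrow> Comp C f (Id C (Cod C f)) = f"
    and Comp_assoc: "\<lbrakk>f \<in> Hom C; g \<in> Hom C; h \<in> Hom C; Cod C f = Dom C g; Cod C g = Dom C h\<rbrakk>
      \<Longrightarrow> Comp C (Comp C f g) h = Comp C f (Comp C g h)"

record ('o, 'a) groupoid = "('o, 'a) category" +
  Inv :: "'a \<Rightarrow> 'a"

(* An ordered basis is a list, so every space having one is finite-dimensional. *)

definition ordered_basis :: "real poly set \<Rightarrow> real poly list \<Rightarrow> bool" where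
  "ordered_basis V v \<longleftrightarrow>
     distinct v \<and> poly_vs.independent (set v) \<and> poly_vs.span (set v) = V"

(* For a basis b, representation b p x is the coefficient of the basis element x in p. *)

definition change_of_basis_matrix :: "real poly list \<Rightarrow> real poly list \<Rightarrow> real mat" where
  "change_of_basis_matrix v t =
     mat (length v) (length t) (\<lambda>(i, j). poly_vs.representation (set v) (t ! j) (v ! i))"

(* A morphism carries its source and target: different pairs of bases can have the same matrix
   (for instance, every identity morphism has the identity matrix). *)

datatype basis_arrow =
  Arrow (source: "real poly list") (matrix: "real mat") (target: "real poly list")

definition cb_groupoid :: "real poly list set \<Rightarrow> (real poly list, basis_arrow) groupoid" where
  "cb_groupoid B =
    \<lparr> Obj = B,
      Hom = {Arrow v (change_of_basis_matrix v t) t | v t. v \<in> B \<and> t \<in> B},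
      Dom = source,
      Cod = target,
      Id = (\<lambda>v. Arrow v (change_of_basis_matrix v v) v),
      Comp = (\<lambda>f g. Arrow (source f) (matrix f * matrix g) (target g)),
      Inv = (\<lambda>f. Arrow (target f) (the (mat_inverse (matrix f))) (source f)) \<rparr>"

definition change_of_basis_groupoid :: "(real poly list, basis_arrow) groupoid \<Rightarrow> bool" where
  "change_of_basis_groupoid CB \<longleftrightarrow>
     (\<exists>B V. finite B \<and> (\<forall>v\<in>B. ordered_basis V v) \<and> CB = cb_groupoid B)"

end

theory Submission
  imports Defs
begin

text \<open>
  The only mathematical content is the cocycle identity \<open>M\<^bsub>v r\<^esub> * M\<^bsub>r t\<^esub> = M\<^bsub>v t\<^esub>\<close> for bases of one
  space. It expresses linearity of coordinates: expand each element of \<open>t\<close> in the basis \<open>r\<close> and take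
  coordinates with respect to \<open>v\<close> on both sides.

  Every category axiom then becomes bookkeeping. Since a morphism of a change of basis groupoid is
  determined by its source and target, the cocycle identity says that composing \<open>v \<rightarrow> r\<close> with
  \<open>r \<rightarrow> t\<close> yields the morphism \<open>v \<rightarrow> t\<close>. Associativity is an equality of two morphisms
  with equal end points, and the unit laws are the cases \<open>r = v\<close> and \<open>r = t\<close>.
\<close>

context vector_space
begin

text \<open>
  Holds because \<open>representation B\<close> is linear on the span of \<open>B\<close>, applied to the expansion of \<open>p\<close>
  in the basis \<open>R\<close>.
\<close>

lemma representation_change_basis:
  assumes B: "independent B" and R: "independent R" "finite R"
    and RB: "R \<subseteq> span B" and p: "p \<in> span R"
  shows "representation B p x = (\<Sum>b\<in>R. representation B b x * representation R p b)"
proof -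
  have "p = (\<Sum>b\<in>R. scale (representation R p b) b)"
    using sum_representation_eq[OF R(1) p R(2)] by simp
  then have "representation B p x = representation B (\<Sum>b\<in>R. scale (representation R p b) b) x"
    by simp
  also have "\<dots> = (\<Sum>b\<in>R. representation B (scale (representation R p b) b) x)"
    using RB by (subst representation_sum[OF B]) (auto intro: span_scale)
  also have "\<dots> = (\<Sum>b\<in>R. representation B b x * representation R p b)"
    using RB by (intro sum.cong) (auto simp: representation_scale[OF B] mult.commute)
  finally show ?thesis .
qed

end

lemma change_of_basis_matrix_mult:
  assumes v: "ordered_basis V v" and r: "ordered_basis V r" and t: "ordered_basis V t"
  shows "change_of_basis_matrix v r * change_of_basis_matrix r t = change_of_basis_matrix v t"
proof (rule eq_matI)
  fix i j
  assume "i < dim_row (change_of_basis_matrix v t)" "j < dim_col (change_of_basis_matrix v t)"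
  then have i: "i < length v" and j: "j < length t"
    by (simp_all add: change_of_basis_matrix_def)
  have "t ! j \<in> poly_vs.span (set t)"
    using j by (simp add: poly_vs.span_base)
  then have tj: "t ! j \<in> poly_vs.span (set r)"
    using r t by (simp add: ordered_basis_def)
  have rv: "set r \<subseteq> poly_vs.span (set v)"
    using v r poly_vs.span_superset[of "set r"] by (simp add: ordered_basis_def)
  have "(change_of_basis_matrix v r * change_of_basis_matrix r t) $$ (i, j)
      = (\<Sum>k<length r. poly_vs.representation (set v) (r ! k) (v ! i)
          * poly_vs.representation (set r) (t ! j) (r ! k))"
    using i j by (simp add: change_of_basis_matrix_def scalar_prod_def lessThan_atLeast0)
  also have "\<dots> = (\<Sum>b\<in>set r. poly_vs.representation (set v) b (v ! i)
      * poly_vs.representation (set r) (t ! j) b)"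
    \<comment> \<open>distinctness of \<open>r\<close> makes the positions of the list index its set of elements\<close>
    using r by (intro sum.reindex_bij_betw bij_betw_nth) (simp_all add: ordered_basis_def)
  also have "\<dots> = poly_vs.representation (set v) (t ! j) (v ! i)"
    using v r rv tj
    by (intro poly_vs.representation_change_basis[symmetric]) (simp_all add: ordered_basis_def)
  finally show "(change_of_basis_matrix v r * change_of_basis_matrix r t) $$ (i, j)
      = change_of_basis_matrix v t $$ (i, j)"
    using i j by (simp add: change_of_basis_matrix_def)
qed (simp_all add: change_of_basis_matrix_def)

lemma small_category_cb_groupoid:
  assumes "\<And>v. v \<in> B \<Longrightarrow> ordered_basis V v"
  shows "small_category (cb_groupoid B)"
proof -
  have mult: "change_of_basis_matrix v r * change_of_basis_matrix r t = change_of_basis_matrix v t"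
    if "v \<in> B" "r \<in> B" "t \<in> B" for v r t
    using that assms by (blast intro: change_of_basis_matrix_mult)
  show ?thesis
    by unfold_locales (auto simp: cb_groupoid_def mult)
qed

theorem lemma9:
  fixes CB :: "(real poly list, basis_arrow) groupoid"
  assumes "change_of_basis_groupoid CB"
  shows "small_category CB
    \<and> finite (Obj CB)
    \<and> (\<exists>V. \<forall>v\<in>Obj CB. ordered_basis V v)
    \<and> (\<forall>f\<in>Hom CB. matrix f = change_of_basis_matrix (Dom CB f) (Cod CB f))
    \<and> (\<forall>v\<in>Obj CB. \<forall>t\<in>Obj CB. \<exists>!f. f \<in> Hom CB \<and> Dom CB f = v \<and> Cod CB f = t)"
proof -
  obtain B V where B: "finite B" "\<And>v. v \<in> B \<Longrightarrow> ordered_basis V v" and CB: "CB = cb_groupoid B"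
    using assms unfolding change_of_basis_groupoid_def by blast
  have "small_category CB"
    unfolding CB using B(2) by (rule small_category_cb_groupoid)
  moreover have "finite (Obj CB)" "\<exists>V. \<forall>v\<in>Obj CB. ordered_basis V v"
    using B by (auto simp: CB cb_groupoid_def)
  moreover have "\<forall>f\<in>Hom CB. matrix f = change_of_basis_matrix (Dom CB f) (Cod CB f)"
    by (auto simp: CB cb_groupoid_def)
  moreover have "\<forall>v\<in>Obj CB. \<forall>t\<in>Obj CB. \<exists>!f. f \<in> Hom CB \<and> Dom CB f = v \<and> Cod CB f = t"
  proof (intro ballI)
    fix v t
    assume "v \<in> Obj CB" "t \<in> Obj CB"
    then show "\<exists>!f. f \<in> Hom CB \<and> Dom CB f = v \<and> Cod CB f = t"
      by (intro ex1I[of _ "Arrow v (change_of_basis_matrix v t) t"]) (auto simp: CB cb_groupoid_def)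
  qed
  ultimately show ?thesis
    by blast
qed

end
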